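(* Let $S\subset\mathbb{R}^m$ be a finite, totally ordered set of points, let $p:S\to\mathbb{R}$ be a function, let $a_1\in\mathbb{R}$, and let $d\ge 0$ be an integer. Then the algorithm DualAlpha (described in the context), run on the input $(S,p,a_1,d)$, computes the weighted alpha complex up to dimension $d$. That is, its output $(X,w,\Phi)$ satisfies: (i) $X$ is the $d$-skeleton of $\mathrm{Alpha}(S,p,a_1)$, i.e. $X$ is exactly the set of simplices of $\mathrm{Alpha}(S,p,a_1)$ of dimension at most $d$; (ii) for every $\sigma\in X$, $w(\sigma)\in(-\infty,a_1]$ is the weight of $\sigma$ in the filtered complex $\mathrm{Alpha}(S,p)$; (iii) for every $\sigma\in X$, $\Phi(\sigma)\in\mathbb{R}^m$ is the value of the witness map at $\sigma$, i.e. the unique point of $V_\sigma$ at which $\pi_x$ (for any $x\in\sigma$) attains its minimum over $V_\sigma$.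
   Context: **Simplicial complexes.** A simplicial complex on a finite totally ordered vertex set $S$ is a collection $X$ of nonempty subsets of $S$ closed under taking nonempty subsets (not every element of $S$ need be a vertex of $X$). A simplex with $k+1$ elements has dimension $k$ and is written $[\sigma_0,\dots,\sigma_k]$ with its distinct elements listed in increasing order. $X_k$ is the set of $k$-dimensional simplices, and $\mathrm{Skel}_k(X)$ (the $k$-skeleton) is the set of simplices of dimension at most $k$. $\mathrm{Lazy}_k(X)$ is the largest simplicial complex $Z$ on vertex set $S$ with $\mathrm{Skel}_k(Z)=\mathrm{Skel}_k(X)$. A filtered complex is a complex $X$ with a weight function $w:X\to\mathbb{R}$ such that $X(a)=w^{-1}((-\infty,a])$ is a complex for every $a\in\mathbb{R}$; it is equivalently given by the nested family $X(a)$, with $w(\sigma)$ the smallest $a$ such that $\sigma\in X(a)$. The nerve of a family $\{U_x:x\in S\}$ of subsets of $\mathbb{R}^m$ is the complex of all nonempty $\sigma\subset S$ with $\bigcap_{x\in\sigma}U_x\ne\emptyset$. **Power diagrams, Čech and alpha complexes.** For $x\in S$ and $y\in\mathbb{R}^m$ put $\pi_x(y)=\|y-x\|^2-p(x)$. For $a\in\mathbb{R}$ let $U_x(a)=\{y\in\mathbb{R}^m:\pi_x(y)\le a\}$ (a closed ball or empty), and let $V_x=\{y\in\mathbb{R}^m:\pi_x(y)\le\pi_{x'}(y)\text{ for all }x'\in S\}$. For nonempty $\sigma\subset S$ let $V_\sigma=\bigcap_{x\in\sigma}V_x$; on $V_\sigma$ all functions $\pi_x$, $x\in\sigma$, coincide.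 $\mathrm{\check{C}ech}(S,p,a)$ is the nerve of $\{U_x(a):x\in S\}$. The weighted alpha complex $\mathrm{Alpha}(S,p)$ is the filtered complex whose subcomplex at level $a$, denoted $\mathrm{Alpha}(S,p,a)$, is the nerve of $\{U_x(a)\cap V_x:x\in S\}$. **The subroutine DualQP.** For a symmetric positive semidefinite $n\times n$ real matrix $B$, a vector $U\in\mathbb{R}^n$, a subset $J\subset\{1,\dots,n\}$, and $c_1\in\mathbb{R}$, consider the problem of maximizing $-\tfrac12\lambda^tB\lambda+U^t\lambda$ over $\lambda\in\mathbb{R}^n$ subject to $\lambda_i\ge 0$ for all $i\notin J$. If the supremum is at most $c_1$, then $\mathrm{DualQP}(B,U,J,c_1)$ returns $(\lambda^*,c^* )$, where $\lambda^*$ is a maximizer and $c^*$ is the maximum value. If the supremum exceeds $c_1$ (including when it is $+\infty$), it returns $c^*=\infty$ and an arbitrary $\lambda^*$. **The algorithm DualAlpha.** Input: $(S,p,a_1,d)$. 1. Set $Y=\mathrm{Skel}_1(\mathrm{\check{C}ech}(S,p,a_1))$, and let $G$ be the graph whose vertices are the elements of $Y_0$ and whose edges are the elements of $Y_1$. Set $X=\emptyset$. 2. For $k=0,1,\dots,d$ in order: (a) Set $\Sigma_k=Y_k$ if $k\le 1$, and $\Sigma_k=(\mathrm{Lazy}_{k-1}(X))_k$ if $k\ge 2$ (with $X$ as it is at the beginning of step $k$). (b) For each $x\in S$: let $\{x_1,\dots,x_n\}$ be the set of neighbors of $x$ in $G$ (empty if $x$ is not a vertex of $G$). Let $B$ be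 the $n\times n$ matrix with entries $B_{i,j}=(x_i-x)^t(x_j-x)$, let $U\in\mathbb{R}^n$ have entries $U_i=\tfrac12\left(p(x_i)-p(x)-\|x_i-x\|^2\right)$, and let $c_1=(a_1+p(x))/2$. For each $\sigma=[x,x_{j_1},\dots,x_{j_k}]\in\Sigma_k$ having $x$ as its first (smallest) element, let $J=\{j_1,\dots,j_k\}$ and compute $(\lambda^*,c^* )=\mathrm{DualQP}(B,U,J,c_1)$. If $c^*\le c_1$, add $\sigma$ to $X$ and set $w(\sigma)=2c^*-p(x)$ and $\Phi(\sigma)=x-\sum_{j=1}^n\lambda^*_j(x_j-x)$. 3. Output $(X,w,\Phi)$. *)

theory Defs
  imports "HOL-Analysis.Analysis" "Jordan_Normal_Form.Matrix"
begin

text \<open>A simplex is represented by its vertex set; dimension \<open>k\<close> means \<open>k + 1\<close> vertices.\<close>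

definition complex_on :: "'a set \<Rightarrow> 'a set set \<Rightarrow> bool" where
  "complex_on S X \<longleftrightarrow>
     (\<forall>\<sigma>\<in>X. \<sigma> \<noteq> {} \<and> \<sigma> \<subseteq> S \<and> (\<forall>\<tau>. \<tau> \<noteq> {} \<and> \<tau> \<subseteq> \<sigma> \<longrightarrow> \<tau> \<in> X))"

definition simplices :: "nat \<Rightarrow> 'a set set \<Rightarrow> 'a set set" where
  "simplices k X = {\<sigma> \<in> X. card \<sigma> = k + 1}"

definition Skel :: "nat \<Rightarrow> 'a set set \<Rightarrow> 'a set set" where
  "Skel k X = {\<sigma> \<in> X. card \<sigma> \<le> k + 1}"

definition Lazy :: "'a set \<Rightarrow> nat \<Rightarrow> 'a set set \<Rightarrow> 'a set set" where
  "Lazy S k X = (GREATEST Z. complex_on S Z \<and> Skel k Z = Skel k X)"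

definition nerve :: "'a set \<Rightarrow> ('a \<Rightarrow> 'b set) \<Rightarrow> 'a set set" where
  "nerve S U = {\<sigma>. \<sigma> \<noteq> {} \<and> \<sigma> \<subseteq> S \<and> (\<Inter>x\<in>\<sigma>. U x) \<noteq> {}}"

text \<open>A filtered complex is given by its nested family of sublevel complexes \<open>F a\<close>.\<close>

definition is_weight :: "(real \<Rightarrow> 'a set set) \<Rightarrow> 'a set \<Rightarrow> real \<Rightarrow> bool" where
  "is_weight F \<sigma> c \<longleftrightarrow> \<sigma> \<in> F c \<and> (\<forall>a. \<sigma> \<in> F a \<longrightarrow> c \<le> a)"

definition power_dist :: "('a::euclidean_space \<Rightarrow> real) \<Rightarrow> 'a \<Rightarrow> 'a \<Rightarrow> real" where
  "power_dist p x y = (norm (y - x))\<^sup>2 - p x"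

definition power_ball :: "('a::euclidean_space \<Rightarrow> real) \<Rightarrow> real \<Rightarrow> 'a \<Rightarrow> 'a set" where
  "power_ball p a x = {y. power_dist p x y \<le> a}"

definition power_cell :: "'a set \<Rightarrow> ('a::euclidean_space \<Rightarrow> real) \<Rightarrow> 'a \<Rightarrow> 'a set" where
  "power_cell S p x = {y. \<forall>x'\<in>S. power_dist p x y \<le> power_dist p x' y}"

definition power_face :: "'a set \<Rightarrow> ('a::euclidean_space \<Rightarrow> real) \<Rightarrow> 'a set \<Rightarrow> 'a set" where
  "power_face S p \<sigma> = (\<Inter>x\<in>\<sigma>. power_cell S p x)"

definition Cech :: "'a set \<Rightarrow> ('a::euclidean_space \<Rightarrow> real) \<Rightarrow> real \<Rightarrow> 'a set set" where
  "Cech S p a = nerve S (power_ball p a)"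

definition Alpha :: "'a set \<Rightarrow> ('a::euclidean_space \<Rightarrow> real) \<Rightarrow> real \<Rightarrow> 'a set set" where
  "Alpha S p a = nerve S (\<lambda>x. power_ball p a x \<inter> power_cell S p x)"

definition is_witness :: "'a set \<Rightarrow> ('a::euclidean_space \<Rightarrow> real) \<Rightarrow> 'a set \<Rightarrow> 'a \<Rightarrow> bool" where
  "is_witness S p \<sigma> y \<longleftrightarrow>
     (\<forall>x\<in>\<sigma>. {z. is_arg_min (power_dist p x) (\<lambda>z. z \<in> power_face S p \<sigma>) z} = {y})"

text \<open>Indices of vectors and matrices run over \<open>0, \<dots>, n - 1\<close>, also in the set \<open>J\<close> below.\<close>

definition pos_semidef :: "nat \<Rightarrow> real mat \<Rightarrow> bool" where
  "pos_semidef n B \<longleftrightarrow> B \<in> carrier_mat n n \<and> transpose_mat B = B \<and>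
     (\<forall>v \<in> carrier_vec n. 0 \<le> scalar_prod v (B *\<^sub>v v))"

definition qp_objective :: "real mat \<Rightarrow> real Matrix.vec \<Rightarrow> real Matrix.vec \<Rightarrow> real" where
  "qp_objective B U l = - (1/2) * scalar_prod l (B *\<^sub>v l) + scalar_prod U l"

definition qp_feasible :: "nat \<Rightarrow> nat set \<Rightarrow> real Matrix.vec set" where
  "qp_feasible n J = {l \<in> carrier_vec n. \<forall>i<n. i \<notin> J \<longrightarrow> 0 \<le> vec_index l i}"

text \<open>DualQP is specified by its input/output behaviour. The supremum is taken in \<open>ereal\<close>, and if
  it exceeds \<open>c1\<close>, the first component of the result is left unconstrained.\<close>

type_synonym qp_solver =
  "real mat \<Rightarrow> real Matrix.vec \<Rightarrow> nat set \<Rightarrow> real \<Rightarrow> real Matrix.vec \<times> ereal"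

definition is_DualQP :: "qp_solver \<Rightarrow> bool" where
  "is_DualQP qp \<longleftrightarrow>
     (\<forall>n B U J c1. pos_semidef n B \<and> U \<in> carrier_vec n \<and> J \<subseteq> {..<n} \<longrightarrow>
        (let (l, c) = qp B U J c1 in
           if (SUP l' \<in> qp_feasible n J. ereal (qp_objective B U l')) \<le> ereal c1
           then is_arg_max (qp_objective B U) (\<lambda>l'. l' \<in> qp_feasible n J) l \<and>
                c = ereal (qp_objective B U l)
           else c = \<infinity>))"

text \<open>The choice of a numbering \<open>x\<^sub>1, \<dots>, x\<^sub>n\<close> of the set of neighbors of \<open>x\<close> is made
  by a function \<open>enum x\<close>, which turns finite sets into lists.\<close>

definition is_enumeration :: "('a \<Rightarrow> 'a set \<Rightarrow> 'a list) \<Rightarrow> bool" where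
  "is_enumeration enum \<longleftrightarrow> (\<forall>x A. finite A \<longrightarrow> distinct (enum x A) \<and> set (enum x A) = A)"

definition neighbors :: "'a set set \<Rightarrow> 'a \<Rightarrow> 'a set" where
  "neighbors Y x = {z. {x, z} \<in> simplices 1 Y}"

definition first :: "('a \<times> 'a) set \<Rightarrow> 'a set \<Rightarrow> 'a" where
  "first r \<sigma> = (THE x. x \<in> \<sigma> \<and> (\<forall>z\<in>\<sigma>. (x, z) \<in> r))"

definition gram :: "'a::euclidean_space \<Rightarrow> 'a list \<Rightarrow> real mat" where
  "gram x xs = Matrix.mat (length xs) (length xs) (\<lambda>(i, j). inner (xs ! i - x) (xs ! j - x))"

definition offsets :: "('a::euclidean_space \<Rightarrow> real) \<Rightarrow> 'a \<Rightarrow> 'a list \<Rightarrow> real Matrix.vec" where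
  "offsets p x xs =
     Matrix.vec (length xs) (\<lambda>i. 1/2 * (p (xs ! i) - p x - (norm (xs ! i - x))\<^sup>2))"

text \<open>Treatment of a single candidate simplex \<open>\<sigma>\<close>: the pair \<open>(w \<sigma>, \<Phi> \<sigma>)\<close> if \<open>\<sigma>\<close>
  is accepted, and \<open>None\<close> otherwise. In every call made by the algorithm the elements of \<open>\<sigma>\<close>
  other than \<open>x\<close> are neighbors of \<open>x\<close>, so \<open>J\<close> is the set of their positions in \<open>xs\<close>.\<close>

definition test_simplex ::
  "qp_solver \<Rightarrow> ('a \<Rightarrow> 'a set \<Rightarrow> 'a list) \<Rightarrow> ('a \<times> 'a) set \<Rightarrow> 'a set set \<Rightarrow>
   ('a::euclidean_space \<Rightarrow> real) \<Rightarrow> real \<Rightarrow> 'a set \<Rightarrow> (real \<times> 'a) option" where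
  "test_simplex qp enum r Y p a1 \<sigma> =
     (let x = first r \<sigma>;
          xs = enum x (neighbors Y x);
          n = length xs;
          J = {j. j < n \<and> xs ! j \<in> \<sigma>};
          c1 = (a1 + p x) / 2;
          (l, c) = qp (gram x xs) (offsets p x xs) J c1
      in if c \<le> ereal c1
         then Some (2 * real_of_ereal c - p x, x - (\<Sum>j<n. vec_index l j *\<^sub>R (xs ! j - x)))
         else None)"

type_synonym 'a state = "'a set set \<times> ('a set \<Rightarrow> real) \<times> ('a set \<Rightarrow> 'a)"

text \<open>Step \<open>k\<close> of the main loop. The candidates are fixed at the beginning of the step and every
  candidate has exactly one first element, so the loops over \<open>x \<in> S\<close> and over the candidates with
  first element \<open>x\<close> amount to one simultaneous update.\<close>

definition DualAlpha_step ::
  "qp_solver \<Rightarrow> ('a \<Rightarrow> 'a set \<Rightarrow> 'a list) \<Rightarrow> ('a \<times> 'a) set \<Rightarrow> 'a set \<Rightarrow> 'a set set \<Rightarrow>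
   ('a::euclidean_space \<Rightarrow> real) \<Rightarrow> real \<Rightarrow> nat \<Rightarrow> 'a state \<Rightarrow> 'a state" where
  "DualAlpha_step qp enum r S Y p a1 k = (\<lambda>(X, w, \<Phi>).
     let candidates = simplices k (if k \<le> 1 then Y else Lazy S (k - 1) X);
         test = test_simplex qp enum r Y p a1;
         new = {\<sigma> \<in> candidates. test \<sigma> \<noteq> None}
     in (X \<union> new,
         \<lambda>\<sigma>. if \<sigma> \<in> new then fst (the (test \<sigma>)) else w \<sigma>,
         \<lambda>\<sigma>. if \<sigma> \<in> new then snd (the (test \<sigma>)) else \<Phi> \<sigma>))"

definition DualAlpha ::
  "qp_solver \<Rightarrow> ('a \<Rightarrow> 'a set \<Rightarrow> 'a list) \<Rightarrow> ('a \<times> 'a) set \<Rightarrow> 'a set \<Rightarrow>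
   ('a::euclidean_space \<Rightarrow> real) \<Rightarrow> real \<Rightarrow> nat \<Rightarrow> 'a state" where
  "DualAlpha qp enum r S p a1 d =
     fold (DualAlpha_step qp enum r S (Skel 1 (Cech S p a1)) p a1) [0..<Suc d]
       ({}, \<lambda>_. undefined, \<lambda>_. undefined)"

end

theory Submission
  imports Defs
begin

text \<open>For \<open>x\<close> the first element of \<open>\<sigma>\<close>, the quadratic program passed to the solver is the
  Lagrange dual of minimizing \<open>1/2 * (norm (y - x))\<^sup>2\<close> over those \<open>y\<close> whose power distance to \<open>x\<close>
  is at most the one to each neighbor of \<open>x\<close>, with equality for the neighbors in \<open>\<sigma>\<close>. If the dual
  has a maximizer, its first order optimality conditions say that the associated point is primal
  feasible and has the same value; if the primal problem has a solution of value at most \<open>c1\<close>, weak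
  duality bounds the supremum. Non-neighbors impose no further constraint below level \<open>a1\<close>, since a
  point where one of them wins lies in both balls and would make it a neighbor.\<close>

section \<open>Duality\<close>

text \<open>This is the quadratic objective for a Gram matrix given by its factors \<open>v\<close>,
  with the quadratic form written as a squared norm. Points of the dual are functions, so that a
  single coordinate can be varied by \<open>fun_upd\<close>.\<close>

definition dual_objective ::
  "nat \<Rightarrow> (nat \<Rightarrow> 'a::real_inner) \<Rightarrow> (nat \<Rightarrow> real) \<Rightarrow> (nat \<Rightarrow> real) \<Rightarrow> real" where
  "dual_objective n v u l =
     - (1/2) * (norm (\<Sum>j<n. l j *\<^sub>R v j))\<^sup>2 + (\<Sum>j<n. u j * l j)"

text \<open>Here \<open>z\<close> stands for the displacement \<open>y - x\<close> from the base
  point. By \<open>power_dist_diff\<close>, each left-hand side will be half of a difference of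
  power distances at \<open>y\<close>.\<close>

definition primal_feasible ::
  "nat \<Rightarrow> nat set \<Rightarrow> (nat \<Rightarrow> 'a::real_inner) \<Rightarrow> (nat \<Rightarrow> real) \<Rightarrow> 'a \<Rightarrow> bool" where
  "primal_feasible n J v u z \<longleftrightarrow>
     (\<forall>i<n. inner z (v i) + u i \<le> 0 \<and> (i \<in> J \<longrightarrow> inner z (v i) + u i = 0))"

definition dual_feasible :: "nat \<Rightarrow> nat set \<Rightarrow> (nat \<Rightarrow> real) \<Rightarrow> bool" where
  "dual_feasible n J l \<longleftrightarrow> (\<forall>i<n. i \<notin> J \<longrightarrow> 0 \<le> l i)"

text \<open>Dividing by \<open>t\<close> and letting \<open>t\<close> tend to 0 gives the claim;
  this takes the place of differentiation in the optimality conditions.\<close>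

lemma slope_nonpos_if_below_parabola:
  fixes b e g :: real
  assumes "0 < e" and below: "\<And>t. 0 < t \<Longrightarrow> t \<le> e \<Longrightarrow> t * g \<le> t\<^sup>2 * b"
  shows "g \<le> 0"
proof (rule ccontr)
  assume "\<not> g \<le> 0"
  hence g: "0 < g" by simp
  \<comment> \<open>This \<open>t\<close> is small enough for \<open>t * b\<close> to be at most
    \<open>g / 2\<close>; the summand 1 keeps the denominator positive.\<close>
  define t where "t = min e (g / (2 * (\<bar>b\<bar> + 1)))"
  have t: "0 < t" "t \<le> e" using g \<open>0 < e\<close> by (auto simp: t_def)
  have "t * g \<le> t * (t * b)" using below[OF t] by (simp add: power2_eq_square mult_ac)
  hence "g \<le> t * b" using t by simp
  also have "t * b \<le> t * (\<bar>b\<bar> + 1)" using t by (intro mult_left_mono) auto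
  also have "\<dots> \<le> g / (2 * (\<bar>b\<bar> + 1)) * (\<bar>b\<bar> + 1)"
    by (intro mult_right_mono) (auto simp: t_def)
  also have "\<dots> = g / 2" by (simp add: field_simps add_eq_0_iff)
  finally show False using g by simp
qed

text \<open>The expansion along one coordinate is exact. Its linear coefficient, the partial
  derivative, is the left-hand side of the primal constraint \<open>i\<close> at
  \<open>z = - (\<Sum>j<n. l j *\<^sub>R v j)\<close>.\<close>

lemma dual_objective_fun_upd:
  assumes "i < n"
  shows "dual_objective n v u (l(i := l i + t)) = dual_objective n v u l
    + t * (inner (- (\<Sum>j<n. l j *\<^sub>R v j)) (v i) + u i) - t\<^sup>2 * ((norm (v i))\<^sup>2 / 2)"
proof -
  let ?s = "\<Sum>j<n. l j *\<^sub>R v j"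
  have "(l(i := l i + t)) j = l j + (if j = i then t else 0)" for j by simp
  hence eq: "(l(i := l i + t)) = (\<lambda>j. l j + (if j = i then t else 0))" by blast
  have "(\<Sum>j<n. (if j = i then t else 0) *\<^sub>R v j) = (\<Sum>j<n. if j = i then t *\<^sub>R v j else 0)"
    by (intro sum.cong) auto
  hence 1: "(\<Sum>j<n. (l(i := l i + t)) j *\<^sub>R v j) = ?s + t *\<^sub>R v i"
    unfolding eq using assms by (simp add: scaleR_add_left sum.distrib)
  have "(\<Sum>j<n. u j * (if j = i then t else 0)) = (\<Sum>j<n. if j = i then u j * t else 0)"
    by (intro sum.cong) auto
  hence 2: "(\<Sum>j<n. u j * (l(i := l i + t)) j) = (\<Sum>j<n. u j * l j) + u i * t"
    unfolding eq using assms by (simp add: distrib_left sum.distrib)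
  have 3: "(norm (?s + t *\<^sub>R v i))\<^sup>2 = (norm ?s)\<^sup>2 + 2 * t * inner ?s (v i) + t\<^sup>2 * (norm (v i))\<^sup>2"
    by (simp only: power2_norm_eq_inner)
       (simp add: inner_add_left inner_add_right inner_commute power2_eq_square algebra_simps)
  show ?thesis
    unfolding dual_objective_def 1 2 3 by (simp add: algebra_simps)
qed

text \<open>These are the Karush-Kuhn-Tucker conditions, obtained by varying one coordinate.
  Increasing \<open>l i\<close> is always allowed and gives the inequality; decreasing it is allowed
  if \<open>i \<in> J\<close> or \<open>l i > 0\<close> and gives equality, hence complementary
  slackness.\<close>

lemma dual_maximizer_optimality:
  fixes v :: "nat \<Rightarrow> 'a::real_inner"
  assumes feas: "dual_feasible n J l"
    and max: "\<And>l'. dual_feasible n J l' \<Longrightarrow> dual_objective n v u l' \<le> dual_objective n v u l"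
  defines "z \<equiv> - (\<Sum>j<n. l j *\<^sub>R v j)"
  shows "primal_feasible n J v u z" and "i < n \<Longrightarrow> l i * (inner z (v i) + u i) = 0"
proof -
  have step: "t * (inner z (v i) + u i) \<le> t\<^sup>2 * ((norm (v i))\<^sup>2 / 2)"
    if "i < n" "i \<in> J \<or> 0 \<le> l i + t" for i t
  proof -
    have "dual_feasible n J (l(i := l i + t))" using feas that by (auto simp: dual_feasible_def)
    from max[OF this] show ?thesis
      unfolding dual_objective_fun_upd[OF \<open>i < n\<close>] z_def by simp
  qed
  have le: "inner z (v i) + u i \<le> 0" if "i < n" for i
  proof (rule slope_nonpos_if_below_parabola[of 1 _ "(norm (v i))\<^sup>2 / 2"])
    show "t * (inner z (v i) + u i) \<le> t\<^sup>2 * ((norm (v i))\<^sup>2 / 2)" if "0 < t" for t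
      using feas that \<open>i < n\<close> by (intro step) (auto simp: dual_feasible_def)
  qed simp
  have eq: "inner z (v i) + u i = 0" if "i < n" and "i \<in> J \<or> l i \<noteq> 0" for i
  proof -
    \<comment> \<open>Length of an admissible decrease: arbitrary for a free coordinate, at most
      \<open>l i\<close> for a sign-constrained one.\<close>
    define e where "e = (if i \<in> J then 1 else l i)"
    have "- (inner z (v i) + u i) \<le> 0"
    proof (rule slope_nonpos_if_below_parabola[of e _ "(norm (v i))\<^sup>2 / 2"])
      show "0 < e" using that feas by (auto simp: e_def dual_feasible_def order_le_less)
      show "t * - (inner z (v i) + u i) \<le> t\<^sup>2 * ((norm (v i))\<^sup>2 / 2)" if "t \<le> e" for t
        using step[OF \<open>i < n\<close>, of "- t", unfolded mult_minus_left power2_minus] that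
        unfolding mult_minus_right by (auto simp: e_def split: if_splits)
    qed
    thus ?thesis using le[OF \<open>i < n\<close>] by simp
  qed
  show "primal_feasible n J v u z" using le eq by (auto simp: primal_feasible_def)
  show "i < n \<Longrightarrow> l i * (inner z (v i) + u i) = 0" using eq[of i] by auto
qed

text \<open>Each product of a multiplier with its constraint is at most 0: the constraint is tight
  on \<open>J\<close>, and the signs are opposite elsewhere.\<close>

lemma sum_dual_offsets_le:
  assumes "primal_feasible n J v u z" and "dual_feasible n J l"
  shows "(\<Sum>j<n. u j * l j) \<le> - inner z (\<Sum>j<n. l j *\<^sub>R v j)"
proof -
  have "l j * (inner z (v j) + u j) \<le> 0" if "j < n" for j
  proof (cases "j \<in> J")
    case True thus ?thesis using assms(1) that by (auto simp: primal_feasible_def)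
  next
    case False thus ?thesis using assms that
      by (auto simp: primal_feasible_def dual_feasible_def intro: mult_nonneg_nonpos)
  qed
  hence "(\<Sum>j<n. l j * (inner z (v j) + u j)) \<le> 0" by (intro sum_nonpos) auto
  thus ?thesis by (simp add: inner_sum_right algebra_simps sum.distrib)
qed

text \<open>Complete the square: the gap is at least half the squared norm of
  \<open>z + (\<Sum>j<n. l j *\<^sub>R v j)\<close>.\<close>

lemma weak_duality:
  assumes "primal_feasible n J v u z" and "dual_feasible n J l"
  shows "dual_objective n v u l \<le> (norm z)\<^sup>2 / 2"
proof -
  let ?s = "\<Sum>j<n. l j *\<^sub>R v j"
  have "0 \<le> (norm (z + ?s))\<^sup>2" by simp
  also have "\<dots> = (norm z)\<^sup>2 + 2 * inner z ?s + (norm ?s)\<^sup>2"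
    by (simp only: power2_norm_eq_inner)
       (simp add: inner_add_left inner_add_right inner_commute)
  finally show ?thesis
    using sum_dual_offsets_le[OF assms] by (simp add: dual_objective_def)
qed

text \<open>Complementary slackness turns \<open>sum_dual_offsets_le\<close> into an equality at
  \<open>z\<close>, which is strong duality. For another feasible \<open>z'\<close> it gives
  \<open>inner (z' - z) z \<ge> 0\<close>, so \<open>z\<close> is the projection of the origin onto
  the feasible set; the extra square later yields uniqueness of the witness.\<close>

lemma dual_maximizer_value:
  fixes v :: "nat \<Rightarrow> 'a::real_inner"
  assumes feas: "dual_feasible n J l"
    and max: "\<And>l'. dual_feasible n J l' \<Longrightarrow> dual_objective n v u l' \<le> dual_objective n v u l"
  defines "z \<equiv> - (\<Sum>j<n. l j *\<^sub>R v j)"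
  shows "dual_objective n v u l = (norm z)\<^sup>2 / 2"
    and "primal_feasible n J v u z' \<Longrightarrow> (norm z)\<^sup>2 + (norm (z' - z))\<^sup>2 \<le> (norm z')\<^sup>2"
proof -
  have "(\<Sum>j<n. l j * (inner z (v j) + u j)) = 0"
    using dual_maximizer_optimality(2)[OF feas max] by (intro sum.neutral) (auto simp: z_def)
  hence "(\<Sum>j<n. u j * l j) = - inner z (\<Sum>j<n. l j *\<^sub>R v j)"
    by (simp add: inner_sum_right algebra_simps sum.distrib)
  also have "\<dots> = (norm z)\<^sup>2" by (simp add: z_def power2_norm_eq_inner)
  finally have u: "(\<Sum>j<n. u j * l j) = (norm z)\<^sup>2" .
  thus "dual_objective n v u l = (norm z)\<^sup>2 / 2"
    by (simp add: dual_objective_def z_def)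
  assume "primal_feasible n J v u z'"
  from sum_dual_offsets_le[OF this feas] have "(norm z)\<^sup>2 \<le> inner z' z"
    unfolding u by (simp add: z_def)
  moreover have "(norm (z' - z))\<^sup>2 = (norm z')\<^sup>2 - 2 * inner z' z + (norm z)\<^sup>2"
    by (simp only: power2_norm_eq_inner)
       (simp add: inner_diff_left inner_diff_right inner_commute)
  ultimately show "(norm z)\<^sup>2 + (norm (z' - z))\<^sup>2 \<le> (norm z')\<^sup>2" by simp
qed

section \<open>The solver on Gram matrices\<close>

lemma scalar_prod_gram:
  assumes "l \<in> carrier_vec (length xs)"
  shows "scalar_prod l (gram x xs *\<^sub>v l)
    = (norm (\<Sum>j<length xs. vec_index l j *\<^sub>R (xs ! j - x)))\<^sup>2"
  using assms
  by (simp add: gram_def scalar_prod_def power2_norm_eq_inner inner_sum_left inner_sum_right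
      lessThan_atLeast0 sum_distrib_left mult_ac)
     (intro sum.cong refl, simp add: inner_commute)

lemma pos_semidef_gram: "pos_semidef (length xs) (gram x xs)"
  by (auto simp: pos_semidef_def scalar_prod_gram)
     (auto simp: gram_def inner_commute)

text \<open>The entry of \<open>offsets\<close> that belongs to a point \<open>x'\<close>,
  independent of any numbering; it is the constant term in \<open>power_dist_diff\<close>.\<close>

definition offset :: "('a::euclidean_space \<Rightarrow> real) \<Rightarrow> 'a \<Rightarrow> 'a \<Rightarrow> real" where
  "offset p x x' = 1/2 * (p x' - p x - (norm (x' - x))\<^sup>2)"

lemma qp_objective_gram:
  assumes "l \<in> carrier_vec (length xs)"
  shows "qp_objective (gram x xs) (offsets p x xs) l =
    dual_objective (length xs) (\<lambda>j. xs ! j - x) (\<lambda>j. offset p x (xs ! j)) (vec_index l)"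
  unfolding qp_objective_def scalar_prod_gram[OF assms] dual_objective_def
  using assms by (simp add: scalar_prod_def offsets_def offset_def lessThan_atLeast0)

lemma dual_objective_cong:
  assumes "\<And>j. j < n \<Longrightarrow> l j = l' j"
  shows "dual_objective n v u l = dual_objective n v u l'"
  using assms by (simp add: dual_objective_def)

text \<open>The solver's specification in primal terms. A rejection certifies, by weak duality, that
  every feasible point has value above \<open>c1\<close>; an acceptance yields the primal minimizer
  and its value.\<close>

lemma DualQP_gram:
  fixes x :: "'a::euclidean_space"
  assumes qp: "is_DualQP qp" and J: "J \<subseteq> {..<length xs}"
    and res: "qp (gram x xs) (offsets p x xs) J c1 = (l, c)"
  defines "n \<equiv> length xs" and "v \<equiv> \<lambda>j. xs ! j - x" and "u \<equiv> \<lambda>j. offset p x (xs ! j)"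
  defines "z \<equiv> - (\<Sum>j<n. vec_index l j *\<^sub>R v j)"
  shows "\<not> c \<le> ereal c1 \<Longrightarrow> primal_feasible n J v u z' \<Longrightarrow> c1 < (norm z')\<^sup>2 / 2"
    and "c \<le> ereal c1 \<Longrightarrow> c = ereal ((norm z)\<^sup>2 / 2)"
    and "c \<le> ereal c1 \<Longrightarrow> primal_feasible n J v u z"
    and "c \<le> ereal c1 \<Longrightarrow> primal_feasible n J v u z' \<Longrightarrow>
      (norm z)\<^sup>2 + (norm (z' - z))\<^sup>2 \<le> (norm z')\<^sup>2"
proof -
  let ?obj = "qp_objective (gram x xs) (offsets p x xs)"
  let ?sup = "SUP l'\<in>qp_feasible n J. ereal (?obj l')"
  have spec: "if ?sup \<le> ereal c1
    then is_arg_max ?obj (\<lambda>l'. l' \<in> qp_feasible n J) l \<and> c = ereal (?obj l) else c = \<infinity>"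
    using qp[unfolded is_DualQP_def, rule_format, of n "gram x xs" "offsets p x xs" J c1]
      J pos_semidef_gram[of xs x] res
    by (auto simp: n_def Let_def offsets_def)
  have obj: "?obj l' = dual_objective n v u (vec_index l')" and
    feas: "dual_feasible n J (vec_index l')" if "l' \<in> qp_feasible n J" for l'
    using that by (auto simp: qp_feasible_def qp_objective_gram n_def v_def u_def dual_feasible_def)
  show "c1 < (norm z')\<^sup>2 / 2" if "\<not> c \<le> ereal c1" "primal_feasible n J v u z'"
  proof (rule ccontr)
    assume "\<not> c1 < (norm z')\<^sup>2 / 2"
    hence "?obj l' \<le> c1" if "l' \<in> qp_feasible n J" for l'
      using weak_duality[OF \<open>primal_feasible n J v u z'\<close> feas[OF that]] obj[OF that] by simp
    hence "?sup \<le> ereal c1" by (intro SUP_least) simp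
    hence "c = ereal (?obj l)" "l \<in> qp_feasible n J" using spec by (auto simp: is_arg_max_def)
    \<comment> \<open>The returned value is attained at a feasible point, so it is bounded by the
      supremum and hence by \<open>c1\<close>, contrary to the rejection.\<close>
    thus False using \<open>?sup \<le> ereal c1\<close> that(1) by (auto simp: SUP_le_iff)
  qed
  assume "c \<le> ereal c1"
  \<comment> \<open>The failure value is infinite, so \<open>c \<le> ereal c1\<close> selects the
    first branch of the specification.\<close>
  hence arg: "is_arg_max ?obj (\<lambda>l'. l' \<in> qp_feasible n J) l" and c: "c = ereal (?obj l)"
    using spec by (auto split: if_splits)
  hence l: "l \<in> qp_feasible n J" by (auto simp: is_arg_max_def)
  have max: "dual_objective n v u f \<le> dual_objective n v u (vec_index l)"
    if "dual_feasible n J f" for f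
  proof -
    \<comment> \<open>Only the values of \<open>f\<close> below \<open>n\<close> enter the
      objective, so \<open>f\<close> may be truncated to a vector.\<close>
    have f: "Matrix.vec n f \<in> qp_feasible n J"
      using that by (auto simp: qp_feasible_def dual_feasible_def)
    hence "?obj (Matrix.vec n f) \<le> ?obj l" using arg by (auto simp: is_arg_max_linorder)
    thus ?thesis unfolding obj[OF f] obj[OF l]
      using dual_objective_cong[of n "vec_index (Matrix.vec n f)" f v u] by simp
  qed
  note opt = feas[OF l] max
  show "c = ereal ((norm z)\<^sup>2 / 2)"
    using dual_maximizer_value(1)[OF opt] c obj[OF l] by (simp add: z_def)
  show "primal_feasible n J v u z"
    using dual_maximizer_optimality(1)[OF opt] by (simp add: z_def)
  show "primal_feasible n J v u z' \<Longrightarrow> (norm z)\<^sup>2 + (norm (z' - z))\<^sup>2 \<le> (norm z')\<^sup>2"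
    using dual_maximizer_value(2)[OF opt] by (simp add: z_def)
qed

section \<open>Power cells\<close>

text \<open>The terms quadratic in \<open>y\<close> cancel, so bisectors of power distances are
  affine. This is why the cell constraints are linear.\<close>

lemma power_dist_diff:
  "power_dist p x y - power_dist p x' y = 2 * (inner (y - x) (x' - x) + offset p x x')"
proof -
  have "(norm (y - x'))\<^sup>2 = (norm (y - x))\<^sup>2 - 2 * inner (y - x) (x' - x) + (norm (x' - x))\<^sup>2"
    by (simp only: power2_norm_eq_inner)
       (simp add: inner_diff_left inner_diff_right inner_commute algebra_simps)
  thus ?thesis by (simp add: power_dist_def offset_def algebra_simps)
qed

lemma power_dist_le_iff:
  "power_dist p x y \<le> power_dist p x' y \<longleftrightarrow> inner (y - x) (x' - x) + offset p x x' \<le> 0"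
  unfolding le_iff_diff_le_0[of "power_dist p x y"] power_dist_diff mult_le_0_iff by simp

lemma power_dist_eq_iff:
  "power_dist p x y = power_dist p x' y \<longleftrightarrow> inner (y - x) (x' - x) + offset p x x' = 0"
  unfolding eq_iff_diff_eq_0[of "power_dist p x y"] power_dist_diff mult_eq_0_iff by simp

text \<open>Vertices of \<open>\<sigma>\<close> dominate each other on the face, so their power
  distances agree there, and the comparison with \<open>S\<close> can be made from one vertex
  \<open>x\<close>.\<close>

lemma mem_power_face_iff:
  assumes "x \<in> \<sigma>" "\<sigma> \<subseteq> S"
  shows "y \<in> power_face S p \<sigma> \<longleftrightarrow>
    (\<forall>x'\<in>S. power_dist p x y \<le> power_dist p x' y) \<and>
    (\<forall>x'\<in>\<sigma>. power_dist p x y = power_dist p x' y)"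
proof
  assume "y \<in> power_face S p \<sigma>"
  hence "\<forall>z\<in>\<sigma>. \<forall>x'\<in>S. power_dist p z y \<le> power_dist p x' y"
    by (auto simp: power_face_def power_cell_def)
  thus "(\<forall>x'\<in>S. power_dist p x y \<le> power_dist p x' y) \<and>
    (\<forall>x'\<in>\<sigma>. power_dist p x y = power_dist p x' y)"
    using assms by (meson order_antisym subsetD)
next
  assume "(\<forall>x'\<in>S. power_dist p x y \<le> power_dist p x' y) \<and>
    (\<forall>x'\<in>\<sigma>. power_dist p x y = power_dist p x' y)"
  thus "y \<in> power_face S p \<sigma>" by (auto simp: power_face_def power_cell_def)
qed

lemma mem_Alpha_iff:
  assumes "x \<in> \<sigma>"
  shows "\<sigma> \<in> Alpha S p a \<longleftrightarrow> \<sigma> \<subseteq> S \<and> (\<exists>y\<in>power_face S p \<sigma>. power_dist p x y \<le> a)"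
proof (cases "\<sigma> \<subseteq> S")
  case True
  have "y \<in> (\<Inter>z\<in>\<sigma>. power_ball p a z \<inter> power_cell S p z) \<longleftrightarrow>
    y \<in> power_face S p \<sigma> \<and> power_dist p x y \<le> a" for y
  proof -
    have "y \<in> (\<Inter>z\<in>\<sigma>. power_ball p a z \<inter> power_cell S p z) \<longleftrightarrow>
      y \<in> power_face S p \<sigma> \<and> (\<forall>z\<in>\<sigma>. power_dist p z y \<le> a)"
      by (auto simp: power_face_def power_ball_def)
    also have "\<dots> \<longleftrightarrow> y \<in> power_face S p \<sigma> \<and> power_dist p x y \<le> a"
      using mem_power_face_iff[OF assms True, of y p] assms by metis
    finally show ?thesis .
  qed
  hence "(\<Inter>z\<in>\<sigma>. power_ball p a z \<inter> power_cell S p z) =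
    {y \<in> power_face S p \<sigma>. power_dist p x y \<le> a}" by blast
  thus ?thesis using True assms by (auto simp: Alpha_def nerve_def)
qed (auto simp: Alpha_def nerve_def)

lemma Alpha_subset_Cech: "Alpha S p a \<subseteq> Cech S p a"
  by (auto simp: Alpha_def Cech_def nerve_def)

section \<open>Simplicial complexes, nerves and the neighbor graph\<close>

lemma complex_onI:
  assumes "\<And>\<sigma>. \<sigma> \<in> X \<Longrightarrow> \<sigma> \<noteq> {}" "\<And>\<sigma>. \<sigma> \<in> X \<Longrightarrow> \<sigma> \<subseteq> S"
    and "\<And>\<sigma> \<tau>. \<sigma> \<in> X \<Longrightarrow> \<tau> \<noteq> {} \<Longrightarrow> \<tau> \<subseteq> \<sigma> \<Longrightarrow> \<tau> \<in> X"
  shows "complex_on S X"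
  unfolding complex_on_def
proof (intro ballI conjI allI impI)
  fix \<sigma> assume "\<sigma> \<in> X"
  thus "\<sigma> \<noteq> {}" "\<sigma> \<subseteq> S" using assms(1,2) by simp_all
next
  fix \<sigma> \<tau> assume "\<sigma> \<in> X" "\<tau> \<noteq> {} \<and> \<tau> \<subseteq> \<sigma>"
  thus "\<tau> \<in> X" using assms(3)[of \<sigma> \<tau>] by simp
qed

lemma complex_on_faceD:
  assumes "complex_on S X" "\<sigma> \<in> X" "\<tau> \<noteq> {}" "\<tau> \<subseteq> \<sigma>"
  shows "\<tau> \<in> X"
  using assms(1)[unfolded complex_on_def, rule_format, OF assms(2)] assms(3,4) by blast

lemma complex_on_simplexD:
  assumes "complex_on S X" "\<sigma> \<in> X"
  shows "\<sigma> \<noteq> {}" "\<sigma> \<subseteq> S"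
  using assms(1)[unfolded complex_on_def, rule_format, OF assms(2)] by blast+

lemma complex_on_nerve: "complex_on S (nerve S U)"
proof (rule complex_onI)
  fix \<sigma> \<tau> assume \<sigma>: "\<sigma> \<in> nerve S U" and \<tau>: "\<tau> \<noteq> {}" "\<tau> \<subseteq> \<sigma>"
  have "(\<Inter>x\<in>\<sigma>. U x) \<subseteq> (\<Inter>x\<in>\<tau>. U x)" using \<tau>(2) by (rule INF_superset_mono) simp
  thus "\<tau> \<in> nerve S U" using \<sigma> \<tau> by (auto simp: nerve_def)
qed (auto simp: nerve_def)

lemma mem_neighbors_iff:
  "z \<in> neighbors (Skel 1 Y) x \<longleftrightarrow> z \<noteq> x \<and> {x, z} \<in> Y"
  by (cases "z = x") (auto simp: neighbors_def simplices_def Skel_def)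

lemma neighbors_Cech_subset: "neighbors (Skel 1 (Cech S p a)) x \<subseteq> S"
  unfolding subset_iff mem_neighbors_iff by (auto simp: Cech_def nerve_def)

lemma power_dist_le_if_le_neighbors:
  assumes x: "x \<in> S" "power_dist p x y \<le> a"
    and nb: "\<And>z. z \<in> neighbors (Skel 1 (Cech S p a)) x \<Longrightarrow> power_dist p x y \<le> power_dist p z y"
    and x': "x' \<in> S"
  shows "power_dist p x y \<le> power_dist p x' y"
proof (rule ccontr)
  assume less: "\<not> power_dist p x y \<le> power_dist p x' y"
  hence "y \<in> (\<Inter>z\<in>{x, x'}. power_ball p a z)" using x by (auto simp: power_ball_def)
  hence "{x, x'} \<in> Cech S p a" using x x' by (auto simp: Cech_def nerve_def)
  \<comment> \<open>The inequality in \<open>less\<close> is strict, so \<open>x'\<close> differs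
    from \<open>x\<close> and the edge makes it a neighbor.\<close>
  thus False using nb[of x', unfolded mem_neighbors_iff] less by auto
qed

section \<open>Correctness of the test of a simplex\<close>

definition alpha_values ::
  "'a::euclidean_space set \<Rightarrow> ('a \<Rightarrow> real) \<Rightarrow> real \<Rightarrow> 'a set \<Rightarrow> real \<Rightarrow> 'a \<Rightarrow> bool" where
  "alpha_values S p a1 \<sigma> c y \<longleftrightarrow> c \<le> a1 \<and> is_weight (Alpha S p) \<sigma> c \<and> is_witness S p \<sigma> y"

text \<open>The hypothesis on edges makes every vertex of \<open>\<sigma>\<close> other than
  \<open>x\<close> a neighbor, so the equality constraints indexed by \<open>J\<close> cover all of
  \<open>\<sigma>\<close>. Below level \<open>a1\<close> the primal feasible set is then the power
  face.\<close>

lemma test_simplex_correct: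
  fixes S :: "'a::euclidean_space set"
  assumes S: "finite S" and qp: "is_DualQP qp" and en: "is_enumeration enum"
    and x_def: "x = first r \<sigma>" and x: "x \<in> \<sigma>" and \<sigma>: "\<sigma> \<subseteq> S"
    and edges: "\<And>z. z \<in> \<sigma> \<Longrightarrow> z \<noteq> x \<Longrightarrow> {x, z} \<in> Cech S p a1"
  shows "case test_simplex qp enum r (Skel 1 (Cech S p a1)) p a1 \<sigma> of
    None \<Rightarrow> \<sigma> \<notin> Alpha S p a1
  | Some (c, y) \<Rightarrow> \<sigma> \<in> Alpha S p a1 \<and> alpha_values S p a1 \<sigma> c y"
proof -
  let ?Y = "Skel 1 (Cech S p a1)"
  define xs where "xs = enum x (neighbors ?Y x)"
  define n where "n = length xs"
  define J where "J = {j. j < n \<and> xs ! j \<in> \<sigma>}"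
  define c1 where "c1 = (a1 + p x) / 2"
  obtain l c where res: "qp (gram x xs) (offsets p x xs) J c1 = (l, c)" by fastforce
  define v where "v = (\<lambda>j. xs ! j - x)"
  define u where "u = (\<lambda>j. offset p x (xs ! j))"
  define z where "z = - (\<Sum>j<n. vec_index l j *\<^sub>R (xs ! j - x))"
  have test: "test_simplex qp enum r ?Y p a1 \<sigma> =
    (if c \<le> ereal c1 then Some (2 * real_of_ereal c - p x, x + z) else None)"
    unfolding test_simplex_def Let_def x_def[symmetric] xs_def[symmetric] n_def[symmetric]
      J_def[symmetric] c1_def[symmetric] res z_def by simp
  have set_xs: "set xs = neighbors ?Y x"
    using en finite_subset[OF neighbors_Cech_subset S]
    by (auto simp: xs_def is_enumeration_def)
  have xs: "(\<exists>j<n. xs ! j = z) \<longleftrightarrow> z \<in> neighbors ?Y x" for z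
    unfolding set_xs[symmetric] n_def by (metis in_set_conv_nth)
  have J: "J \<subseteq> {..<length xs}" by (auto simp: J_def n_def)
  note sol = DualQP_gram[OF qp J res, folded n_def, folded z_def v_def u_def]
  have pf: "primal_feasible n J v u (y - x) \<longleftrightarrow>
    (\<forall>x'\<in>neighbors ?Y x. power_dist p x y \<le> power_dist p x' y \<and>
      (x' \<in> \<sigma> \<longrightarrow> power_dist p x y = power_dist p x' y))" for y
  proof -
    have "primal_feasible n J v u (y - x) \<longleftrightarrow>
      (\<forall>i<n. power_dist p x y \<le> power_dist p (xs ! i) y \<and>
        (xs ! i \<in> \<sigma> \<longrightarrow> power_dist p x y = power_dist p (xs ! i) y))"
      unfolding primal_feasible_def v_def u_def power_dist_le_iff power_dist_eq_iff
      by (auto simp: J_def)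
    also have "\<dots> \<longleftrightarrow> (\<forall>x'\<in>neighbors ?Y x. power_dist p x y \<le> power_dist p x' y \<and>
      (x' \<in> \<sigma> \<longrightarrow> power_dist p x y = power_dist p x' y))"
      using xs by metis
    finally show ?thesis .
  qed
  have face_pf: "primal_feasible n J v u (y - x)" if "y \<in> power_face S p \<sigma>" for y
    using that neighbors_Cech_subset[of S p a1 x] unfolding pf mem_power_face_iff[OF x \<sigma>] by blast
  \<comment> \<open>Unlike \<open>face_pf\<close>, this direction needs the level bound, which
    controls the points of \<open>S\<close> that are not neighbors.\<close>
  have pf_face: "y \<in> power_face S p \<sigma>"
    if y: "primal_feasible n J v u (y - x)" "power_dist p x y \<le> a1" for y
  proof -
    have "x \<in> S" using x \<sigma> by auto
    have nb: "\<And>x'. x' \<in> neighbors ?Y x \<Longrightarrow> power_dist p x y \<le> power_dist p x' y \<and>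
      (x' \<in> \<sigma> \<longrightarrow> power_dist p x y = power_dist p x' y)" using y(1)[unfolded pf] by blast
    have "power_dist p x y = power_dist p x' y" if "x' \<in> \<sigma>" for x'
      using nb[of x', unfolded mem_neighbors_iff] edges[of x'] that by auto
    moreover have "power_dist p x y \<le> power_dist p x' y" if "x' \<in> S" for x'
      using power_dist_le_if_le_neighbors[OF \<open>x \<in> S\<close> y(2) _ that] nb by blast
    ultimately show ?thesis unfolding mem_power_face_iff[OF x \<sigma>] by blast
  qed
  show ?thesis
  proof (cases "c \<le> ereal c1")
    case False
    have "a1 < power_dist p x y" if "y \<in> power_face S p \<sigma>" for y
      using sol(1)[OF False face_pf[OF that]] by (simp add: c1_def power_dist_def)
    hence "\<sigma> \<notin> Alpha S p a1" unfolding mem_Alpha_iff[OF x] by (auto simp: not_le)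
    thus ?thesis using False test by simp
  next
    case True
    define y where "y = x + z"
    define a where "a = power_dist p x y"
    have c: "c = ereal ((norm z)\<^sup>2 / 2)" using sol(2)[OF True] .
    hence w: "2 * real_of_ereal c - p x = a" by (simp add: a_def y_def power_dist_def)
    have "a \<le> a1" using True c by (simp add: c1_def a_def y_def power_dist_def)
    have y: "y \<in> power_face S p \<sigma>"
      using pf_face[of y] sol(3)[OF True] \<open>a \<le> a1\<close> by (simp add: y_def a_def)
    have min: "a + (norm (y' - y))\<^sup>2 \<le> power_dist p x y'" if "y' \<in> power_face S p \<sigma>" for y'
      using sol(4)[OF True face_pf[OF that]]
      by (simp add: a_def y_def power_dist_def algebra_simps)
    have le: "a \<le> power_dist p x y'" if "y' \<in> power_face S p \<sigma>" for y'
      using min[OF that] by (smt (verit) zero_le_power2)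
    \<comment> \<open>Since \<open>a\<close> is the attained minimum over the whole face, this holds
      at every level \<open>b\<close>, also above \<open>a1\<close>.\<close>
    have Alpha: "\<sigma> \<in> Alpha S p b \<longleftrightarrow> a \<le> b" for b
      unfolding mem_Alpha_iff[OF x] using y le \<sigma> by (force simp: a_def)
    have "is_weight (Alpha S p) \<sigma> a" by (simp add: is_weight_def Alpha)
    moreover have "is_witness S p \<sigma> y"
    proof -
      have "is_arg_min (power_dist p x') (\<lambda>z. z \<in> power_face S p \<sigma>) y' \<longleftrightarrow> y' = y"
        if "x' \<in> \<sigma>" for x' y'
      proof -
        \<comment> \<open>On the face all vertices give the same function, so minimality for
          \<open>x'\<close> reduces to minimality for \<open>x\<close>.\<close>
        have eq: "power_dist p x' y' = power_dist p x y'" if "y' \<in> power_face S p \<sigma>" for y'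
          using that \<open>x' \<in> \<sigma>\<close> unfolding mem_power_face_iff[OF x \<sigma>] by auto
        have "is_arg_min (power_dist p x') (\<lambda>z. z \<in> power_face S p \<sigma>) y' \<longleftrightarrow>
          y' \<in> power_face S p \<sigma> \<and> (\<forall>z\<in>power_face S p \<sigma>. power_dist p x y' \<le> power_dist p x z)"
          using eq by (auto simp: is_arg_min_linorder)
        also have "\<dots> \<longleftrightarrow> y' = y"
        proof
          assume "y' \<in> power_face S p \<sigma> \<and>
            (\<forall>z\<in>power_face S p \<sigma>. power_dist p x y' \<le> power_dist p x z)"
          hence "power_dist p x y' \<le> a" "y' \<in> power_face S p \<sigma>" using y by (auto simp: a_def)
          hence "(norm (y' - y))\<^sup>2 \<le> 0" using min[of y'] by linarith
          thus "y' = y" by simp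
        qed (use y le in \<open>auto simp: a_def\<close>)
        finally show ?thesis .
      qed
      thus ?thesis by (auto simp: is_witness_def)
    qed
    ultimately show ?thesis
      using True test w \<open>a \<le> a1\<close> Alpha by (simp add: alpha_values_def y_def)
  qed
qed

section \<open>The main loop\<close>

text \<open>The description in \<open>first\<close> denotes: a finite nonempty set has a least
  element by induction, and antisymmetry makes it unique.\<close>

lemma first_mem:
  assumes "linear_order_on S r" "finite \<sigma>" "\<sigma> \<noteq> {}" "\<sigma> \<subseteq> S"
  shows "first r \<sigma> \<in> \<sigma>"
proof -
  have refl: "\<And>x. x \<in> S \<Longrightarrow> (x, x) \<in> r" and tr: "trans r" and anti: "antisym r"
    and tot: "\<And>x y. x \<in> S \<Longrightarrow> y \<in> S \<Longrightarrow> (x, y) \<in> r \<or> (y, x) \<in> r"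
    using assms(1)
    by (auto simp: order_on_defs refl_on_def total_on_def) metis
  have "\<exists>x\<in>\<sigma>. \<forall>z\<in>\<sigma>. (x, z) \<in> r"
    using assms(2-4)
  proof (induction \<sigma> rule: finite_ne_induct)
    case (singleton x)
    thus ?case using refl by auto
  next
    case (insert x F)
    then obtain y where y: "y \<in> F" "\<forall>z\<in>F. (y, z) \<in> r" by auto
    show ?case
    proof (cases "(x, y) \<in> r")
      case True
      hence "\<forall>z\<in>insert x F. (x, z) \<in> r" using y refl insert.prems tr by (auto dest: transD)
      thus ?thesis by auto
    next
      case False
      hence "(y, x) \<in> r" using tot[of x y] insert.prems y by auto
      thus ?thesis using y by auto
    qed
  qed
  hence "\<exists>!x. x \<in> \<sigma> \<and> (\<forall>z\<in>\<sigma>. (x, z) \<in> r)" using anti by (auto dest: antisymD)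
  from theI'[OF this] show ?thesis by (simp add: first_def)
qed

text \<open>The explicit set has the right skeleton: a simplex with at most \<open>k + 1\<close>
  vertices is among its own tested faces, and conversely \<open>X\<close> contains all faces of its
  simplices.\<close>

lemma Lazy_eq:
  assumes "complex_on S X"
  shows "Lazy S k X =
    {\<sigma>. \<sigma> \<noteq> {} \<and> \<sigma> \<subseteq> S \<and> (\<forall>\<tau>. \<tau> \<noteq> {} \<and> \<tau> \<subseteq> \<sigma> \<and> card \<tau> \<le> k + 1 \<longrightarrow> \<tau> \<in> X)}"
    (is "_ = ?L")
  unfolding Lazy_def
proof (rule Greatest_equality)
  have "complex_on S ?L" by (auto simp: complex_on_def)
  moreover have "Skel k ?L = Skel k X"
    using assms by (auto simp: Skel_def complex_on_def)
  ultimately show "complex_on S ?L \<and> Skel k ?L = Skel k X" by blast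
next
  fix Z assume Z: "complex_on S Z \<and> Skel k Z = Skel k X"
  show "Z \<subseteq> ?L"
  proof
    fix \<sigma> assume "\<sigma> \<in> Z"
    note \<sigma> = complex_on_simplexD[OF conjunct1[OF Z] this] complex_on_faceD[OF conjunct1[OF Z] this]
    have "\<tau> \<in> X" if "\<tau> \<noteq> {}" "\<tau> \<subseteq> \<sigma>" "card \<tau> \<le> k + 1" for \<tau>
    proof -
      have "\<tau> \<in> Skel k Z" using \<sigma>(3)[of \<tau>] that by (simp add: Skel_def)
      hence "\<tau> \<in> Skel k X" using Z by simp
      thus ?thesis by (simp add: Skel_def)
    qed
    thus "\<sigma> \<in> ?L" using \<sigma> by blast
  qed
qed

text \<open>The loop invariant uses \<open>card \<sigma> \<le> k\<close> instead of \<open>Skel (k - 1)\<close> because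
  truncated subtraction would conflate \<open>k = 0\<close> with \<open>k = 1\<close>.\<close>

definition computed ::
  "'a::euclidean_space set \<Rightarrow> ('a \<Rightarrow> real) \<Rightarrow> real \<Rightarrow> nat \<Rightarrow> 'a state \<Rightarrow> bool" where
  "computed S p a1 k = (\<lambda>(X, w, \<Phi>).
     X = {\<sigma> \<in> Alpha S p a1. card \<sigma> \<le> k} \<and> (\<forall>\<sigma>\<in>X. alpha_values S p a1 \<sigma> (w \<sigma>) (\<Phi> \<sigma>)))"

text \<open>The candidates miss no alpha simplex of dimension \<open>k\<close>, and all their edges
  lie in the Cech complex, as \<open>test_simplex_correct\<close> requires.\<close>

lemma candidates:
  fixes S :: "'a::euclidean_space set"
  assumes S: "finite S" and X: "X = {\<sigma> \<in> Alpha S p a1. card \<sigma> \<le> k}"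
  defines "C \<equiv> simplices k (if k \<le> 1 then Skel 1 (Cech S p a1) else Lazy S (k - 1) X)"
  shows "\<sigma> \<in> Alpha S p a1 \<Longrightarrow> card \<sigma> = Suc k \<Longrightarrow> \<sigma> \<in> C"
    and "\<sigma> \<in> C \<Longrightarrow> \<sigma> \<noteq> {} \<and> \<sigma> \<subseteq> S \<and> card \<sigma> = Suc k"
    and "\<sigma> \<in> C \<Longrightarrow> x \<in> \<sigma> \<Longrightarrow> z \<in> \<sigma> \<Longrightarrow> z \<noteq> x \<Longrightarrow> {x, z} \<in> Cech S p a1"
proof -
  have cplxA: "complex_on S (Alpha S p a1)" by (simp add: Alpha_def complex_on_nerve)
  have "complex_on S X"
  proof (rule complex_onI)
    fix \<sigma> \<tau> assume \<sigma>: "\<sigma> \<in> X" and \<tau>: "\<tau> \<noteq> {}" "\<tau> \<subseteq> \<sigma>"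
    have A: "\<sigma> \<in> Alpha S p a1" using \<sigma> X by simp
    have "finite \<sigma>" using complex_on_simplexD(2)[OF cplxA A] S finite_subset by blast
    hence "card \<tau> \<le> card \<sigma>" using \<tau>(2) by (rule card_mono)
    thus "\<tau> \<in> X" using complex_on_faceD[OF cplxA A \<tau>] \<sigma> by (simp add: X)
  qed (use complex_on_simplexD[OF cplxA] X in simp_all)
  note Lazy = Lazy_eq[OF this, of "k - 1", unfolded One_nat_def]
  show "\<sigma> \<in> C" if \<sigma>: "\<sigma> \<in> Alpha S p a1" "card \<sigma> = Suc k"
  proof (cases "k \<le> 1")
    case True
    thus ?thesis using \<sigma> Alpha_subset_Cech by (auto simp: C_def simplices_def Skel_def)
  next
    case False
    have "\<tau> \<in> X" if "\<tau> \<noteq> {}" "\<tau> \<subseteq> \<sigma>" "card \<tau> \<le> k - 1 + 1" for \<tau>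
      using complex_on_faceD[OF cplxA \<sigma>(1)] that False unfolding X by simp
    moreover note complex_on_simplexD[OF cplxA \<sigma>(1)]
    ultimately show ?thesis using False \<sigma>(2) by (simp add: C_def simplices_def Lazy)
  qed
  show "\<sigma> \<noteq> {} \<and> \<sigma> \<subseteq> S \<and> card \<sigma> = Suc k" if "\<sigma> \<in> C"
    using that by (auto simp: C_def simplices_def Skel_def Cech_def nerve_def Lazy split: if_splits)
  show "{x, z} \<in> Cech S p a1" if "\<sigma> \<in> C" "x \<in> \<sigma>" "z \<in> \<sigma>" "z \<noteq> x"
  proof (cases "k \<le> 1")
    case True
    hence "\<sigma> \<in> Cech S p a1" using that by (auto simp: C_def simplices_def Skel_def)
    thus ?thesis
      using that complex_on_faceD[OF complex_on_nerve, of \<sigma> S "power_ball p a1" "{x, z}"]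
      by (simp add: Cech_def)
  next
    case False
    \<comment> \<open>Here \<open>k \<ge> 2\<close>, so edges belong to the skeleton that the lazy
      complex shares with \<open>X\<close>, and therefore to the alpha complex.\<close>
    have "card {x, z} \<le> k - 1 + 1" using False by (auto simp: card_insert_if)
    hence "{x, z} \<in> X" using that False by (auto simp: C_def simplices_def Lazy)
    thus ?thesis using Alpha_subset_Cech X by auto
  qed
qed

text \<open>On candidates the test decides membership in the alpha complex, and no alpha simplex
  with \<open>k + 1\<close> vertices is missing among them; so \<open>new\<close> consists of
  exactly these.\<close>

lemma computed_step:
  fixes S :: "'a::euclidean_space set"
  assumes S: "finite S" and r: "linear_order_on S r"
    and qp: "is_DualQP qp" and en: "is_enumeration enum"
    and st: "computed S p a1 k st"
  shows "computed S p a1 (Suc k) (DualAlpha_step qp enum r S (Skel 1 (Cech S p a1)) p a1 k st)"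
proof -
  let ?Y = "Skel 1 (Cech S p a1)"
  obtain X w \<Phi> where st_eq: "st = (X, w, \<Phi>)" by (cases st) auto
  have X: "X = {\<sigma> \<in> Alpha S p a1. card \<sigma> \<le> k}"
    and vals: "\<And>\<sigma>. \<sigma> \<in> X \<Longrightarrow> alpha_values S p a1 \<sigma> (w \<sigma>) (\<Phi> \<sigma>)"
    using st by (auto simp: computed_def st_eq)
  define C where "C = simplices k (if k \<le> 1 then ?Y else Lazy S (k - 1) X)"
  define test where "test = test_simplex qp enum r ?Y p a1"
  note cand = candidates[OF S X, folded C_def]
  have ok: "case test \<sigma> of None \<Rightarrow> \<sigma> \<notin> Alpha S p a1
    | Some (c, y) \<Rightarrow> \<sigma> \<in> Alpha S p a1 \<and> alpha_values S p a1 \<sigma> c y" if "\<sigma> \<in> C" for \<sigma>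
  proof -
    have \<sigma>: "\<sigma> \<noteq> {}" "\<sigma> \<subseteq> S" using cand(2)[OF that] by auto
    hence x: "first r \<sigma> \<in> \<sigma>" using first_mem[OF r] finite_subset[OF _ S] by blast
    show ?thesis
      unfolding test_def
      by (rule test_simplex_correct[OF S qp en refl x \<sigma>(2)]) (rule cand(3)[OF that x])
  qed
  define new where "new = {\<sigma> \<in> C. test \<sigma> \<noteq> None}"
  have "test \<sigma> \<noteq> None \<longleftrightarrow> \<sigma> \<in> Alpha S p a1" if "\<sigma> \<in> C" for \<sigma>
    using ok[OF that] by (cases "test \<sigma>") (simp_all split: prod.splits)
  hence new: "new = {\<sigma> \<in> Alpha S p a1. card \<sigma> = Suc k}"
    unfolding new_def using cand(1,2) by blast
  have "DualAlpha_step qp enum r S ?Y p a1 k st =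
    (X \<union> new, \<lambda>\<sigma>. if \<sigma> \<in> new then fst (the (test \<sigma>)) else w \<sigma>,
      \<lambda>\<sigma>. if \<sigma> \<in> new then snd (the (test \<sigma>)) else \<Phi> \<sigma>)"
    unfolding DualAlpha_step_def st_eq new_def C_def test_def Let_def by simp
  moreover have "X \<union> new = {\<sigma> \<in> Alpha S p a1. card \<sigma> \<le> Suc k}"
    unfolding new X by auto
  moreover have "alpha_values S p a1 \<sigma> (fst (the (test \<sigma>))) (snd (the (test \<sigma>)))"
    if "\<sigma> \<in> new" for \<sigma>
    using ok[of \<sigma>] that by (cases "test \<sigma>") (auto simp: new_def)
  ultimately show ?thesis using vals by (auto simp: computed_def)
qed

lemma computed_fold:
  fixes S :: "'a::euclidean_space set"
  assumes "finite S" and "linear_order_on S r" and "is_DualQP qp" and "is_enumeration enum"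
  shows "computed S p a1 k
    (fold (DualAlpha_step qp enum r S (Skel 1 (Cech S p a1)) p a1) [0..<k]
      ({}, \<lambda>_. undefined, \<lambda>_. undefined))"
proof (induction k)
  case 0
  \<comment> \<open>Simplices are nonempty and finite, so the invariant at 0 describes the empty
    complex and the undefined initial maps are unconstrained.\<close>
  have "0 < card \<sigma>" if "\<sigma> \<in> Alpha S p a1" for \<sigma>
    using that assms(1) finite_subset by (auto simp: Alpha_def nerve_def card_gt_0_iff)
  thus ?case by (auto simp: computed_def)
next
  case (Suc k)
  thus ?case using computed_step[OF assms] by simp
qed

theorem proposition1:
  fixes S :: "(real ^ 'm) set" and r :: "((real ^ 'm) \<times> (real ^ 'm)) set"
    and p :: "real ^ 'm \<Rightarrow> real" and a1 :: real and d :: nat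
    and qp :: qp_solver
    and enum :: "real ^ 'm \<Rightarrow> (real ^ 'm) set \<Rightarrow> (real ^ 'm) list"
    and X :: "(real ^ 'm) set set"
    and w :: "(real ^ 'm) set \<Rightarrow> real" and \<Phi> :: "(real ^ 'm) set \<Rightarrow> real ^ 'm"
  assumes "finite S" and "linear_order_on S r"
    and "is_DualQP qp" and "is_enumeration enum"
    and "DualAlpha qp enum r S p a1 d = (X, w, \<Phi>)"
  shows "X = Skel d (Alpha S p a1) \<and>
    (\<forall>\<sigma>\<in>X. w \<sigma> \<le> a1 \<and> is_weight (Alpha S p) \<sigma> (w \<sigma>)) \<and>
    (\<forall>\<sigma>\<in>X. is_witness S p \<sigma> (\<Phi> \<sigma>))"
proof -
  \<comment> \<open>Dimension at most \<open>d\<close> means at most \<open>Suc d\<close> vertices,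
    the bound reached after the steps \<open>0, ..., d\<close>.\<close>
  have "computed S p a1 (Suc d) (X, w, \<Phi>)"
    using computed_fold[OF assms(1-4), of p a1 "Suc d"] assms(5) by (simp only: DualAlpha_def)
  thus ?thesis by (auto simp: computed_def alpha_values_def Skel_def)
qed

end
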